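(* For any $0<p\le 2$ and any lattice $\Lambda\subset\mathbb{R}^n$, let $\sigma_p(\Lambda):=\min_{\lambda\in\Lambda,\,\lambda\neq 0}\|\lambda\|_p$. Then for any $u\ge 1$, $$\#\{\lambda\in\Lambda\setminus\{0\}\ :\ \|\lambda\|_p\le u\,\sigma_p(\Lambda)\}\ \le\ 10\,\frac{e^{u^p}\,n}{p}\,e^{u^p n/p}.$$ In particular, taking $u=1$, the lattice kissing number in the $\ell_p$ norm is $O\!\left(\frac{n}{p}e^{n/p}\right)$ for all $0<p\le 2$, i.e. $\#\{\lambda\in\Lambda:\|\lambda\|_p=\sigma_p(\Lambda)\}= O\!\left(\frac{n}{p}e^{n/p}\right)$ with an absolute implied constant.
   Context: A lattice $\Lambda\subset\mathbb{R}^n$ is the set of integral linear combinations of some basis of $\mathbb{R}^n$. For $p>0$, $\|x\|_p:=(|x_1|^p+\cdots+|x_n|^p)^{1/p}$ (not a norm when $p<1$). The lattice kissing number in the $\ell_p$ norm is the number of non-zero lattice points of minimal $\ell_p$ length. *)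

theory Defs
  imports Complex_Main "Jordan_Normal_Form.VS_Connect"
begin

text \<open>
  Points of \<open>\<real>\<^sup>n\<close> are elements of \<open>carrier_vec n :: real vec set\<close>, so that \<open>n\<close> is an ordinary
  variable and a single constant can be chosen before quantifying over the dimension.
\<close>

definition real_lattice :: "nat \<Rightarrow> real vec set \<Rightarrow> bool" where
  "real_lattice n L \<longleftrightarrow>
     (\<exists>bs. distinct bs \<and>
           vectorspace.basis class_ring (module_vec TYPE(real) n) (set bs) \<and>
           L = vec_module.lattice_of n bs)"

definition lp_length :: "real \<Rightarrow> real vec \<Rightarrow> real" where
  "lp_length p x = (\<Sum>i<dim_vec x. \<bar>x $ i\<bar> powr p) powr (1 / p)"

text \<open>
  The minimum over the nonzero lattice points; \<open>LEAST\<close> is unspecified when there is no least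
  length, as for \<open>n = 0\<close>.
\<close>

definition lp_min_length :: "real \<Rightarrow> nat \<Rightarrow> real vec set \<Rightarrow> real" where
  "lp_min_length p n L = (LEAST r. r \<in> lp_length p ` (L - {0\<^sub>v n}))"

end

theory Submission
  imports "HOL-Probability.Probability" "HOL-Real_Asymp.Real_Asymp" "Jordan_Normal_Form.DL_Rank" Defs
begin

text \<open>
  Write \<open>N(x) = |x_1|^p + ... + |x_n|^p\<close> and consider, for \<open>t > 0\<close>, the function
  \<open>G(x) = (n/p - t N(x)) exp(-t N(x))\<close>. Up to the factor \<open>p\<close> it is the derivative at \<open>r = 1\<close> of
  \<open>r^n exp(-t N(r x))\<close>. The theorem rests on two facts about \<open>G\<close>.

  First, \<open>G\<close> is positive definite (\<open>pos_def_theta_deriv\<close>). On the Fourier side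
  \<open>r^n h(r x)\<close> corresponds to \<open>w \<mapsto> h^(w/r)\<close>, so the claim says that the Fourier transform of
  \<open>exp(-t N)\<close> does not increase along rays from the origin. For a Gaussian this is visible, and for
  \<open>p \<le> 2\<close> the function \<open>exp(-t |x|^p)\<close> is a mixture of Gaussians (\<open>gauss_mix_exp_powr\<close>).
  Products over the coordinates are handled through functions whose product with every positive
  definite function is positive definite; no Fourier transform in several variables occurs.

  Secondly, the sum of a positive definite function over a lattice is nonnegative. The Poisson
  summation formula would show this, but averaging over a large box of lattice points does so too,
  and if the function is nonpositive off the origin then all but finitely many of these points can
  be dropped, which removes every question of convergence
  (\<open>pos_def_int_functions_sum_nonneg\<close>).

  Now let \<open>\<sigma>\<close> be the minimal length and choose \<open>t\<close> with \<open>t \<sigma>^p = n/p + 1\<close>. Then \<open>G(0) = n/p\<close>,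
  whereas every nonzero lattice point \<open>x\<close> has \<open>t N(x) \<ge> n/p + 1\<close> and so
  \<open>G(x) \<le> - exp(-t N(x))\<close>. A vector of length at most \<open>u \<sigma>\<close> therefore contributes at most
  \<open>- exp(-u^p (n/p + 1))\<close> to a nonnegative sum, and there are at most
  \<open>(n/p) exp(u^p (n/p + 1))\<close> of them (\<open>card_short_vectors_le\<close>). The kissing number bound is the
  case \<open>u = 1\<close>, with implied constant \<open>e\<close>.

  The minimal length is defined by a least element, so its existence has to be derived: the integer
  coordinates of a lattice point depend linearly on the point, so only finitely many lattice points
  have bounded length.
\<close>

section \<open>Positive definite functions and their multipliers\<close>

definition pos_def :: "('a::minus \<Rightarrow> real) \<Rightarrow> bool" where
  "pos_def g \<longleftrightarrow> (\<forall>S c. finite S \<longrightarrow> 0 \<le> (\<Sum>x\<in>S. \<Sum>y\<in>S. c x * c y * g (x - y)))"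

lemma pos_defD: "pos_def g \<Longrightarrow> finite S \<Longrightarrow> 0 \<le> (\<Sum>x\<in>S. \<Sum>y\<in>S. c x * c y * g (x - y))"
  unfolding pos_def_def by blast

lemma pos_def_const:
  assumes "0 \<le> a"
  shows "pos_def (\<lambda>_. a)"
proof -
  have "(\<Sum>x\<in>S. \<Sum>y\<in>S. c x * c y * a) = a * (\<Sum>x\<in>S. c x)\<^sup>2" for S :: "'a set" and c
    by (simp add: power2_eq_square sum_product sum_distrib_left sum_distrib_right mult_ac)
  with assms show ?thesis unfolding pos_def_def by simp
qed

lemma pos_def_add:
  assumes "pos_def g" "pos_def h"
  shows "pos_def (\<lambda>x. g x + h x)"
  using assms unfolding pos_def_def by (simp add: distrib_left sum.distrib)

lemma pos_def_scale:
  assumes "pos_def g" "0 \<le> a"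
  shows "pos_def (\<lambda>x. a * g x)"
proof -
  have "(\<Sum>x\<in>S. \<Sum>y\<in>S. c x * c y * (a * g (x - y))) = a * (\<Sum>x\<in>S. \<Sum>y\<in>S. c x * c y * g (x - y))"
    for S c by (simp add: sum_distrib_left mult_ac)
  with assms show ?thesis unfolding pos_def_def by simp
qed

lemma pos_def_lim:
  assumes "\<And>m. pos_def (g m)" and "\<And>x. (\<lambda>m. g m x) \<longlonglongrightarrow> h x"
  shows "pos_def h"
  unfolding pos_def_def
proof (intro allI impI)
  fix S :: "'a set" and c :: "'a \<Rightarrow> real"
  assume "finite S"
  have "(\<lambda>m. \<Sum>x\<in>S. \<Sum>y\<in>S. c x * c y * g m (x - y)) \<longlonglongrightarrow> (\<Sum>x\<in>S. \<Sum>y\<in>S. c x * c y * h (x - y))"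
    by (intro tendsto_sum tendsto_mult tendsto_const assms(2))
  then show "0 \<le> (\<Sum>x\<in>S. \<Sum>y\<in>S. c x * c y * h (x - y))"
    by (rule LIMSEQ_le_const) (use assms(1) \<open>finite S\<close> in \<open>auto intro: pos_defD\<close>)
qed

lemma pos_def_integral:
  fixes H :: "'w \<Rightarrow> 'a::minus \<Rightarrow> real"
  assumes "\<And>w. pos_def (H w)" and int: "\<And>x. integrable M (\<lambda>w. H w x)"
  shows "pos_def (\<lambda>x. \<integral>w. H w x \<partial>M)"
  unfolding pos_def_def
proof (intro allI impI)
  fix S :: "'a set" and c :: "'a \<Rightarrow> real"
  assume "finite S"
  have "(\<Sum>x\<in>S. \<Sum>y\<in>S. c x * c y * (\<integral>w. H w (x - y) \<partial>M))
      = (\<integral>w. (\<Sum>x\<in>S. \<Sum>y\<in>S. c x * c y * H w (x - y)) \<partial>M)"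
    using int by simp
  also have "0 \<le> \<dots>"
    by (intro integral_nonneg_AE AE_I2 pos_defD assms(1) \<open>finite S\<close>)
  finally show "0 \<le> (\<Sum>x\<in>S. \<Sum>y\<in>S. c x * c y * (\<integral>w. H w (x - y) \<partial>M))" .
qed

text \<open>
  By the Schur product theorem every even positive definite function on an abelian group is a
  multiplier in this sense. The functions used below are built from cosines, for which the
  multiplier property follows from an addition formula; this replaces the general theorem.
\<close>

definition multiplier :: "('a::minus \<Rightarrow> real) \<Rightarrow> bool" where
  "multiplier m \<longleftrightarrow> (\<forall>k. pos_def k \<longrightarrow> pos_def (\<lambda>x. k x * m x))"

lemma multiplierI: "(\<And>k. pos_def k \<Longrightarrow> pos_def (\<lambda>x. k x * m x)) \<Longrightarrow> multiplier m"
  unfolding multiplier_def by blast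

lemma multiplierD: "multiplier m \<Longrightarrow> pos_def k \<Longrightarrow> pos_def (\<lambda>x. k x * m x)"
  unfolding multiplier_def by blast

lemma multiplier_imp_pos_def: "multiplier m \<Longrightarrow> pos_def m"
  using multiplierD[OF _ pos_def_const[of 1], of m] by simp

lemma multiplier_const: "0 \<le> a \<Longrightarrow> multiplier (\<lambda>_. a)"
proof (rule multiplierI)
  show "pos_def (\<lambda>x. k x * a)" if "0 \<le> a" "pos_def k" for k :: "'a \<Rightarrow> real"
    using pos_def_scale[OF that(2,1)] by (simp only: mult.commute)
qed

lemma multiplier_add:
  assumes "multiplier g" "multiplier h"
  shows "multiplier (\<lambda>x. g x + h x)"
proof (rule multiplierI)
  show "pos_def (\<lambda>x. k x * (g x + h x))" if "pos_def k" for k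
    unfolding distrib_left by (intro pos_def_add multiplierD assms that)
qed

lemma multiplier_mult:
  assumes "multiplier g" "multiplier h"
  shows "multiplier (\<lambda>x. g x * h x)"
proof (rule multiplierI)
  show "pos_def (\<lambda>x. k x * (g x * h x))" if "pos_def k" for k
    using multiplierD[OF assms(2) multiplierD[OF assms(1) that]] by (simp only: mult.assoc)
qed

lemma multiplier_sum:
  assumes "\<And>i. i \<in> I \<Longrightarrow> multiplier (g i)"
  shows "multiplier (\<lambda>x. \<Sum>i\<in>I. g i x)"
  using assms
  by (induction I rule: infinite_finite_induct) (simp_all add: multiplier_const multiplier_add)

lemma multiplier_prod:
  assumes "\<And>i. i \<in> I \<Longrightarrow> multiplier (g i)"
  shows "multiplier (\<lambda>x. \<Prod>i\<in>I. g i x)"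
  using assms
  by (induction I rule: infinite_finite_induct) (simp_all add: multiplier_const multiplier_mult)

lemma multiplier_lim:
  assumes "\<And>m. multiplier (g m)" and "\<And>x. (\<lambda>m. g m x) \<longlonglongrightarrow> h x"
  shows "multiplier h"
proof (rule multiplierI)
  show "pos_def (\<lambda>x. k x * h x)" if "pos_def k" for k
  proof (rule pos_def_lim)
    show "pos_def (\<lambda>x. k x * g m x)" for m
      by (rule multiplierD[OF assms(1) that])
    show "(\<lambda>m. k x * g m x) \<longlonglongrightarrow> k x * h x" for x
      by (rule tendsto_mult_left[OF assms(2)])
  qed
qed

lemma multiplier_integral:
  fixes H :: "'w \<Rightarrow> 'a::minus \<Rightarrow> real"
  assumes "\<And>w. multiplier (H w)" and int: "\<And>x. integrable M (\<lambda>w. H w x)"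
  shows "multiplier (\<lambda>x. \<integral>w. H w x \<partial>M)"
proof (rule multiplierI)
  fix k :: "'a \<Rightarrow> real"
  assume k: "pos_def k"
  have "pos_def (\<lambda>x. \<integral>w. k x * H w x \<partial>M)"
  proof (rule pos_def_integral)
    show "pos_def (\<lambda>x. k x * H w x)" for w
      by (rule multiplierD[OF assms(1) k])
    show "integrable M (\<lambda>w. k x * H w x)" for x
      using int by simp
  qed
  then show "pos_def (\<lambda>x. k x * (\<integral>w. H w x \<partial>M))"
    by simp
qed

text \<open>
  The addition formula writes \<open>cos (w \<phi>(x - y))\<close> as the sum of two products of a factor in \<open>x\<close> and
  the same factor in \<open>y\<close>; both factors can be absorbed into the coefficients of the quadratic form.
\<close>

lemma multiplier_cos:
  fixes \<phi> :: "'a::minus \<Rightarrow> real"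
  assumes add: "\<And>x y. \<phi> (x - y) = \<phi> x - \<phi> y"
  shows "multiplier (\<lambda>x. cos (w * \<phi> x))"
  unfolding multiplier_def
proof (intro allI impI)
  fix k :: "'a \<Rightarrow> real"
  assume k: "pos_def k"
  show "pos_def (\<lambda>x. k x * cos (w * \<phi> x))"
    unfolding pos_def_def
  proof (intro allI impI)
    fix S :: "'a set" and c :: "'a \<Rightarrow> real"
    assume S: "finite S"
    define a where "a x = c x * cos (w * \<phi> x)" for x
    define b where "b x = c x * sin (w * \<phi> x)" for x
    have "(\<Sum>x\<in>S. \<Sum>y\<in>S. c x * c y * (k (x - y) * cos (w * \<phi> (x - y))))
        = (\<Sum>x\<in>S. \<Sum>y\<in>S. a x * a y * k (x - y)) + (\<Sum>x\<in>S. \<Sum>y\<in>S. b x * b y * k (x - y))"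
      unfolding sum.distrib[symmetric]
    proof (intro sum.cong refl)
      show "c x * c y * (k (x - y) * cos (w * \<phi> (x - y))) = a x * a y * k (x - y) + b x * b y * k (x - y)" for x y
        unfolding add right_diff_distrib cos_diff a_def b_def by (simp add: algebra_simps)
    qed
    also have "0 \<le> \<dots>"
      by (intro add_nonneg_nonneg pos_defD k S)
    finally show "0 \<le> (\<Sum>x\<in>S. \<Sum>y\<in>S. c x * c y * (k (x - y) * cos (w * \<phi> (x - y))))" .
  qed
qed

section \<open>Gaussians\<close>

lemma integrable_cos_std_normal: "integrable lborel (\<lambda>w. std_normal_density w * cos (w * s))"
proof (rule Bochner_Integration.integrable_bound)
  show "integrable lborel std_normal_density" using integrable_normal_density by simp
  show "AE w in lborel. norm (std_normal_density w * cos (w * s)) \<le> norm (std_normal_density w)"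
    by (intro AE_I2) (auto simp: abs_mult intro!: mult_left_le)
qed simp

lemma integral_cos_std_normal: "(\<integral>w. std_normal_density w * cos (w * s) \<partial>lborel) = exp (- s\<^sup>2 / 2)"
proof -
  have "exp (- s\<^sup>2 / 2) = Re (char std_normal_distribution s)"
    by (simp add: char_std_normal_distribution)
  also have "\<dots> = Re (\<integral>w. std_normal_density w *\<^sub>R iexp (s * w) \<partial>lborel)"
    unfolding char_def by (subst integral_density) auto
  also have "\<dots> = (\<integral>w. Re (std_normal_density w *\<^sub>R iexp (s * w)) \<partial>lborel)"
  proof (rule integral_Re[symmetric])
    show "complex_integrable lborel (\<lambda>w. std_normal_density w *\<^sub>R iexp (s * w))"
      by (rule Bochner_Integration.integrable_bound[where f = std_normal_density])
        (auto simp: integrable_normal_density)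
  qed
  finally show ?thesis by (simp add: Re_exp mult.commute)
qed

text \<open>
  A Gaussian is the Fourier transform of a nonnegative density, hence a mixture of cosines.
\<close>

lemma multiplier_gauss:
  assumes add: "\<And>x y. \<phi> (x - y) = \<phi> x - \<phi> y" and b: "0 \<le> b"
  shows "multiplier (\<lambda>x. exp (- b * (\<phi> x)\<^sup>2))"
proof -
  define s where "s = sqrt (2 * b)"
  have s2: "s\<^sup>2 = 2 * b" using b by (simp add: s_def)
  have eq: "exp (- b * (\<phi> x)\<^sup>2) = (\<integral>w. std_normal_density w * cos (w * (s * \<phi> x)) \<partial>lborel)" for x
    by (simp add: integral_cos_std_normal power_mult_distrib s2)
  show ?thesis unfolding eq
  proof (rule multiplier_integral)
    show "multiplier (\<lambda>x. std_normal_density w * cos (w * (s * \<phi> x)))" for w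
      using multiplier_mult[OF multiplier_const multiplier_cos[OF add], of "std_normal_density w" "w * s"]
      by (simp add: mult_ac)
  qed (rule integrable_cos_std_normal)
qed

text \<open>
  Dilating by \<open>r\<close> and multiplying by \<open>r\<close> replaces the density \<open>\<gamma>(w)\<close> of the cosine mixture by
  \<open>\<gamma>(w/r)\<close>. As \<open>\<gamma>\<close> decreases away from \<open>0\<close>, the difference of the two densities is nonnegative.
\<close>

lemma multiplier_gauss_diff:
  assumes add: "\<And>x y. \<phi> (x - y) = \<phi> x - \<phi> y" and b: "0 \<le> b" and r: "1 \<le> r"
  shows "multiplier (\<lambda>x. r * exp (- b * (r * \<phi> x)\<^sup>2) - exp (- b * (\<phi> x)\<^sup>2))"
proof -
  define s where "s = sqrt (2 * b)"
  have s2: "s\<^sup>2 = 2 * b" using b by (simp add: s_def)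
  define \<rho> where "\<rho> w = std_normal_density (w / r)" for w
  have scaled: "integrable lborel (\<lambda>w. \<rho> w * cos (w * (s * t)))" 
    "(\<integral>w. \<rho> w * cos (w * (s * t)) \<partial>lborel) = r * exp (- b * (r * t)\<^sup>2)" for t
  proof -
    let ?f = "\<lambda>w. std_normal_density w * cos (w * (s * (r * t)))"
    have f: "?f (0 + (1 / r) * w) = \<rho> w * cos (w * (s * t))" for w
      using r by (simp add: \<rho>_def)
    show "integrable lborel (\<lambda>w. \<rho> w * cos (w * (s * t)))"
      using lborel_integrable_real_affine[of ?f "1 / r" 0] integrable_cos_std_normal[of "s * (r * t)"] r
      unfolding f by simp
    have "exp (- b * (r * t)\<^sup>2) = (\<integral>w. ?f w \<partial>lborel)"
      by (simp add: integral_cos_std_normal power_mult_distrib s2)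
    also have "\<dots> = (1 / r) * (\<integral>w. \<rho> w * cos (w * (s * t)) \<partial>lborel)"
      using lborel_integral_real_affine[of "1 / r" ?f 0] r unfolding f by simp
    finally show "(\<integral>w. \<rho> w * cos (w * (s * t)) \<partial>lborel) = r * exp (- b * (r * t)\<^sup>2)"
      using r by (simp add: field_simps)
  qed
  have eq: "r * exp (- b * (r * \<phi> x)\<^sup>2) - exp (- b * (\<phi> x)\<^sup>2)
    = (\<integral>w. (\<rho> w - std_normal_density w) * cos (w * (s * \<phi> x)) \<partial>lborel)" for x
    unfolding left_diff_distrib
    by (subst Bochner_Integration.integral_diff)
      (simp_all add: scaled integrable_cos_std_normal integral_cos_std_normal power_mult_distrib s2)
  have mono: "std_normal_density w \<le> \<rho> w" for w
  proof -
    have "(w / r)\<^sup>2 \<le> w\<^sup>2"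
      using mult_right_mono[of 1 "r\<^sup>2" "w\<^sup>2"] r by (simp add: power_divide divide_simps mult.commute)
    then show ?thesis by (simp add: \<rho>_def std_normal_density_def divide_right_mono)
  qed
  show ?thesis unfolding eq
  proof (rule multiplier_integral)
    show "multiplier (\<lambda>x. (\<rho> w - std_normal_density w) * cos (w * (s * \<phi> x)))" for w
      using multiplier_mult[OF multiplier_const multiplier_cos[OF add], of "\<rho> w - std_normal_density w" "w * s"]
        mono[of w] by (simp add: mult_ac)
    show "integrable lborel (\<lambda>w. (\<rho> w - std_normal_density w) * cos (w * (s * \<phi> x)))" for x
      unfolding left_diff_distrib
      by (intro Bochner_Integration.integrable_diff scaled integrable_cos_std_normal)
  qed
qed

section \<open>Mixtures of Gaussians\<close>

text \<open>
  These are the pointwise limits of nonnegative combinations of Gaussians \<open>exp(-b x^2)\<close>, with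
  \<open>b = 0\<close> allowed. The inductive form with a limit rule replaces integrals over a mixing measure: a
  property that is stable under sums, scalings and limits need only be checked on Gaussians.
\<close>

inductive gauss_mix :: "(real \<Rightarrow> real) \<Rightarrow> bool" where
  gauss: "0 \<le> b \<Longrightarrow> gauss_mix (\<lambda>x. exp (- b * x\<^sup>2))"
| scale: "gauss_mix g \<Longrightarrow> 0 \<le> a \<Longrightarrow> gauss_mix (\<lambda>x. a * g x)"
| add: "gauss_mix g \<Longrightarrow> gauss_mix h \<Longrightarrow> gauss_mix (\<lambda>x. g x + h x)"
| lim: "(\<And>m. gauss_mix (g m)) \<Longrightarrow> (\<And>x. (\<lambda>m. g m x) \<longlonglongrightarrow> h x) \<Longrightarrow> gauss_mix h"

lemma gauss_mix_const: "0 \<le> a \<Longrightarrow> gauss_mix (\<lambda>_. a)"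
  using gauss_mix.scale[OF gauss_mix.gauss[of 0], of a] by simp

lemma gauss_mix_mult:
  assumes "gauss_mix g" "gauss_mix h"
  shows "gauss_mix (\<lambda>x. g x * h x)"
  using assms(1)
proof induction
  case (gauss b)
  show ?case using assms(2)
  proof induction
    case (gauss b')
    then show ?case
      using gauss_mix.gauss[of "b + b'"] \<open>0 \<le> b\<close> by (simp add: algebra_simps flip: exp_add)
  next
    case (scale g a)
    then show ?case using gauss_mix.scale[OF scale.IH, of a] by (simp add: mult_ac)
  next
    case (add g h)
    then show ?case using gauss_mix.add by (simp add: distrib_left)
  next
    case (lim g h)
    show ?case
      by (rule gauss_mix.lim[of "\<lambda>m x. exp (- b * x\<^sup>2) * g m x"])
        (intro lim.IH tendsto_intros lim.hyps(2))+
  qed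
next
  case (scale g a)
  then show ?case using gauss_mix.scale[OF scale.IH, of a] by (simp add: mult_ac)
next
  case (add g h)
  then show ?case using gauss_mix.add by (simp add: distrib_right)
next
  case (lim g h')
  show ?case
    by (rule gauss_mix.lim[of "\<lambda>m x. g m x * h x"]) (intro lim.IH tendsto_intros lim.hyps(2))+
qed

lemma gauss_mix_power: "gauss_mix g \<Longrightarrow> gauss_mix (\<lambda>x. g x ^ k)"
  by (induction k) (auto intro: gauss_mix_const gauss_mix_mult)

lemma gauss_mix_sum:
  "(\<And>i. i \<in> I \<Longrightarrow> gauss_mix (g i)) \<Longrightarrow> gauss_mix (\<lambda>x. \<Sum>i\<in>I. g i x)"
  by (induction I rule: infinite_finite_induct) (auto intro: gauss_mix_const gauss_mix.add)

lemma gauss_mix_power_series: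
  assumes "gauss_mix g" and "\<And>k. 0 \<le> c k" and "\<And>x. (\<lambda>k. c k * g x ^ k) sums h x"
  shows "gauss_mix h"
proof (rule gauss_mix.lim)
  show "gauss_mix (\<lambda>x. \<Sum>k<m. c k * g x ^ k)" for m
    by (intro gauss_mix_sum gauss_mix.scale gauss_mix_power assms)
  show "(\<lambda>m. \<Sum>k<m. c k * g x ^ k) \<longlonglongrightarrow> h x" for x
    using assms(3) by (simp add: sums_def)
qed

lemma gauss_mix_exp:
  assumes "gauss_mix g"
  shows "gauss_mix (\<lambda>x. exp (g x))"
  by (rule gauss_mix_power_series[OF assms, of "\<lambda>k. 1 / fact k"])
    (simp_all add: exp_converges[where 'a = real, simplified] divide_inverse)

text \<open>
  For an exponent in \<open>(0, 1]\<close> the binomial series of \<open>1 - (1 - z)^q\<close> has nonnegative coefficients.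
\<close>

lemma gbinomial_sign:
  fixes q :: real
  assumes "0 < q" "q \<le> 1"
  shows "0 \<le> - ((q gchoose Suc k) * (- 1) ^ Suc k)"
proof (induction k)
  case 0
  then show ?case using assms by simp
next
  case (Suc k)
  have eq: "(q gchoose Suc (Suc k)) = (q gchoose Suc k) * (q - of_nat (Suc k)) / of_nat (Suc (Suc k))"
    using gbinomial_mult_1[of q "Suc k"] by (simp add: field_simps)
  have "- ((q gchoose Suc (Suc k)) * (- 1) ^ Suc (Suc k))
    = - ((q gchoose Suc k) * (- 1) ^ Suc k) * ((of_nat (Suc k) - q) / of_nat (Suc (Suc k)))"
    unfolding eq by (simp add: field_simps)
  also have "\<dots> \<ge> 0"
    using Suc assms by (intro mult_nonneg_nonneg divide_nonneg_nonneg) auto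
  finally show ?case .
qed

lemma gauss_mix_one_minus_powr:
  fixes q :: real
  assumes g: "gauss_mix g" and q: "0 < q" "q \<le> 1" and g1: "\<And>x. 0 \<le> g x \<and> g x < 1"
  shows "gauss_mix (\<lambda>x. 1 - (1 - g x) powr q)"
proof (rule gauss_mix_power_series[OF g])
  let ?c = "\<lambda>k. if k = 0 then 0 else - ((q gchoose k) * (- 1) ^ k)"
  show "0 \<le> ?c k" for k
    using gbinomial_sign[OF q, of "k - 1"] by (cases k) auto
  show "(\<lambda>k. ?c k * g x ^ k) sums (1 - (1 - g x) powr q)" for x
  proof -
    have "(\<lambda>k. (q gchoose k) * (- g x) ^ k) sums (1 + - g x) powr q"
      using g1[of x] by (intro gen_binomial_real) auto
    then have "(\<lambda>k. (if k = 0 then 1 else 0) - (q gchoose k) * (- g x) ^ k) sums (1 - (1 + - g x) powr q)"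
      by (intro sums_diff sums_single[of 0 "\<lambda>_. 1", simplified]) auto
    moreover have "(if k = 0 then 1 else 0) - (q gchoose k) * (- g x) ^ k = ?c k * g x ^ k" for k
      by (cases k) (auto simp: power_minus[of "g x"])
    ultimately show ?thesis by simp
  qed
qed

text \<open>
  With \<open>y = x^2\<close> and \<open>q = p/2 \<le> 1\<close> the function is \<open>exp(-t y^q)\<close>, and \<open>y\<close> is the limit of
  \<open>m (1 - z_m)\<close> where \<open>z_m = exp(-y/m)\<close> is a Gaussian in \<open>x\<close>. With \<open>s = t m^q\<close>,
  \<open>exp(-t (m (1 - z_m))^q) = exp(-s) exp(s (1 - (1 - z_m)^q))\<close>, and the last exponent is a power
  series in \<open>z_m\<close> with nonnegative coefficients. This is where \<open>p \<le> 2\<close> is used.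
\<close>

lemma gauss_mix_exp_powr:
  assumes p: "0 < p" "p \<le> 2" and t: "0 \<le> t"
  shows "gauss_mix (\<lambda>x. exp (- t * \<bar>x\<bar> powr p))"
proof (rule gauss_mix.lim)
  define q where "q = p / 2"
  have q: "0 < q" "q \<le> 1" using p by (auto simp: q_def)
  \<comment> \<open>The additional term \<open>1 / (m + 1)\<close> keeps \<open>z\<close> below \<open>1\<close> at \<open>x = 0\<close>, so that the binomial
    series is only used inside its open disc of convergence.\<close>
  define z where "z m x = exp (- (x\<^sup>2 + 1 / real (Suc m)) / real (Suc m))" for m x
  define g where "g m x = exp (- t * (real (Suc m) * (1 - z m x)) powr q)" for m x
  have z: "0 \<le> z m x \<and> z m x < 1" for m x
  proof -
    have "0 < (x\<^sup>2 + 1 / real (Suc m)) / real (Suc m)"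
      by (intro divide_pos_pos add_nonneg_pos) auto
    then show ?thesis unfolding z_def minus_divide_left[symmetric] by (simp only: exp_ge_zero exp_less_one_iff neg_less_0_iff_less simp_thms)
  qed
  show "gauss_mix (g m)" for m
  proof -
    define s where "s = t * real (Suc m) powr q"
    have s: "0 \<le> s" using t by (simp add: s_def)
    have "z m = (\<lambda>x. exp (- (1 / real (Suc m)) / real (Suc m)) * exp (- (1 / real (Suc m)) * x\<^sup>2))"
      unfolding z_def by (intro ext) (simp add: add_divide_distrib diff_divide_distrib flip: exp_add)
    then have "gauss_mix (z m)"
      by (simp only:) (intro gauss_mix.scale gauss_mix.gauss; simp)
    then have "gauss_mix (\<lambda>x. exp (- s) * exp (s * (1 - (1 - z m x) powr q)))"
      using z s q by (intro gauss_mix.scale gauss_mix_exp gauss_mix_one_minus_powr) auto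
    also have "(\<lambda>x. exp (- s) * exp (s * (1 - (1 - z m x) powr q))) = g m"
      unfolding g_def s_def using z
      by (intro ext) (simp only: powr_mult exp_add[symmetric], simp add: algebra_simps)
    finally show ?thesis .
  qed
  show "(\<lambda>m. g m x) \<longlonglongrightarrow> exp (- t * \<bar>x\<bar> powr p)" for x
  proof -
    have lim: "(\<lambda>m. real (Suc m) * (1 - z m x)) \<longlonglongrightarrow> x\<^sup>2"
      unfolding z_def by real_asymp
    have "(\<lambda>m. (real (Suc m) * (1 - z m x)) powr q) \<longlonglongrightarrow> x\<^sup>2 powr q"
      by (rule tendsto_powr'[OF lim tendsto_const])
        (use q z in \<open>auto intro!: always_eventually simp: less_imp_le\<close>)
    also have "x\<^sup>2 powr q = \<bar>x\<bar> powr p"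
    proof (cases "x = 0")
      case False
      then have "x\<^sup>2 = \<bar>x\<bar> powr 2" by simp
      then show ?thesis by (simp only: powr_powr q_def) simp
    qed simp
    finally show ?thesis
      unfolding g_def by (intro tendsto_exp tendsto_mult_left)
  qed
qed

section \<open>Positive definiteness of the dilation derivative\<close>

text \<open>
  For fixed \<open>r\<close> the two conclusions survive sums, scalings and pointwise limits. This would fail
  for the derivative in \<open>r\<close>, which is therefore taken only afterwards.
\<close>

lemma multiplier_gauss_mix:
  fixes \<phi> :: "'a::minus \<Rightarrow> real"
  assumes add: "\<And>x y. \<phi> (x - y) = \<phi> x - \<phi> y" and r: "1 \<le> r" and "gauss_mix h"
  shows "multiplier (\<lambda>x. h (\<phi> x)) \<and> multiplier (\<lambda>x. r * h (r * \<phi> x) - h (\<phi> x))"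
  using assms(3)
proof induction
  case (gauss b)
  then show ?case using multiplier_gauss[where \<phi> = \<phi>, OF add] multiplier_gauss_diff[where \<phi> = \<phi>, OF add _ r] by simp
next
  case (scale g a)
  have "multiplier (\<lambda>x. a * (r * g (r * \<phi> x) - g (\<phi> x)))"
    using scale by (intro multiplier_mult multiplier_const) auto
  then show ?case
    using scale by (auto intro: multiplier_mult multiplier_const simp: algebra_simps)
next
  case (add g h)
  have "multiplier (\<lambda>x. (r * g (r * \<phi> x) - g (\<phi> x)) + (r * h (r * \<phi> x) - h (\<phi> x)))"
    using add by (intro multiplier_add) auto
  then show ?case
    using add by (auto intro: multiplier_add simp: algebra_simps)
next
  case (lim g h)
  show ?case
  proof
    show "multiplier (\<lambda>x. h (\<phi> x))"
      by (rule multiplier_lim[of "\<lambda>m x. g m (\<phi> x)"])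
        (rule conjunct1[OF lim.IH], rule lim.hyps(2))
    show "multiplier (\<lambda>x. r * h (r * \<phi> x) - h (\<phi> x))"
      by (rule multiplier_lim[of "\<lambda>m x. r * g m (r * \<phi> x) - g m (\<phi> x)"])
        (rule conjunct2[OF lim.IH], intro tendsto_diff tendsto_mult_left lim.hyps(2))
  qed
qed

lemma multiplier_exp_powr:
  fixes \<phi> :: "'a::minus \<Rightarrow> real"
  assumes add: "\<And>x y. \<phi> (x - y) = \<phi> x - \<phi> y" and p: "0 < p" "p \<le> 2" and t: "0 \<le> t"
  shows "multiplier (\<lambda>x. exp (- t * \<bar>\<phi> x\<bar> powr p))"
  using multiplier_gauss_mix[where \<phi> = \<phi> and r = 1, OF add order_refl gauss_mix_exp_powr[OF p t]]
  by (rule conjunct1)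

text \<open>
  This is \<open>1/p\<close> times the derivative of \<open>r \<mapsto> r h(r \<phi>(x))\<close> at \<open>r = 1\<close> for
  \<open>h(x) = exp(-t |x|^p)\<close>, and so a limit of difference quotients, which are multipliers.
\<close>

lemma multiplier_exp_powr_deriv:
  assumes add: "\<And>x y. \<phi> (x - y) = \<phi> x - \<phi> y" and p: "0 < p" "p \<le> 2" and t: "0 \<le> t"
  shows "multiplier (\<lambda>x. (1 / p - t * \<bar>\<phi> x\<bar> powr p) * exp (- t * \<bar>\<phi> x\<bar> powr p))"
proof -
  define h where "h x = exp (- t * \<bar>x\<bar> powr p)" for x
  define r where "r m = 1 + 1 / real (Suc m)" for m
  have r: "1 \<le> r m" for m by (simp add: r_def)
  have "multiplier (\<lambda>x. (1 / p) * (real (Suc m) * (r m * h (r m * \<phi> x) - h (\<phi> x))))" for m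
    using multiplier_gauss_mix[where \<phi> = \<phi>, OF add r gauss_mix_exp_powr[OF p t], of m] p
    by (intro multiplier_mult multiplier_const) (auto simp: h_def)
  then show ?thesis
  proof (rule multiplier_lim)
    fix x
    define s where "s = \<bar>\<phi> x\<bar> powr p"
    have "((\<lambda>r. r * exp (- t * (r powr p * s))) has_real_derivative (1 - p * t * s) * exp (- t * s)) (at 1)"
      by (auto intro!: derivative_eq_intros simp: algebra_simps)
    then have "((\<lambda>e. ((1 + e) * exp (- t * ((1 + e) powr p * s)) - exp (- t * s)) / e) \<longlongrightarrow> (1 - p * t * s) * exp (- t * s)) (at 0)"
      by (simp add: DERIV_def)
    moreover have "filterlim (\<lambda>m. 1 / real (Suc m)) (at 0) sequentially"
      by real_asymp
    ultimately have "(\<lambda>m. ((1 + 1 / real (Suc m)) * exp (- t * ((1 + 1 / real (Suc m)) powr p * s)) - exp (- t * s)) / (1 / real (Suc m)))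
       \<longlonglongrightarrow> (1 - p * t * s) * exp (- t * s)"
      by (rule filterlim_compose)
    moreover have "((1 + 1 / real (Suc m)) * exp (- t * ((1 + 1 / real (Suc m)) powr p * s)) - exp (- t * s)) / (1 / real (Suc m))
      = real (Suc m) * (r m * h (r m * \<phi> x) - h (\<phi> x))" for m
      using r[of m] by (simp add: h_def s_def r_def abs_mult powr_mult mult.commute)
    ultimately have "(\<lambda>m. real (Suc m) * (r m * h (r m * \<phi> x) - h (\<phi> x))) \<longlonglongrightarrow> (1 - p * t * s) * exp (- t * s)"
      by (simp only:)
    then have "(\<lambda>m. (1 / p) * (real (Suc m) * (r m * h (r m * \<phi> x) - h (\<phi> x)))) \<longlonglongrightarrow> (1 / p) * ((1 - p * t * s) * exp (- t * s))"
      by (rule tendsto_mult_left)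
    also have "(1 / p) * ((1 - p * t * s) * exp (- t * s)) = (1 / p - t * s) * exp (- t * s)"
      using p by (simp add: field_simps)
    finally show "(\<lambda>m. (1 / p) * (real (Suc m) * (r m * h (r m * \<phi> x) - h (\<phi> x)))) \<longlonglongrightarrow>
      (1 / p - t * \<bar>\<phi> x\<bar> powr p) * exp (- t * \<bar>\<phi> x\<bar> powr p)"
      by (simp add: s_def)
  qed
qed

text \<open>
  By the product rule the \<open>n\<close>-dimensional dilation derivative is a sum over the coordinates of
  products with one differentiated factor.
\<close>

lemma pos_def_theta_deriv:
  fixes \<phi> :: "'i \<Rightarrow> 'a::minus \<Rightarrow> real"
  assumes I: "finite I" and add: "\<And>i x y. \<phi> i (x - y) = \<phi> i x - \<phi> i y"
    and p: "0 < p" "p \<le> 2" and t: "0 \<le> t"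
  defines "N \<equiv> \<lambda>x. \<Sum>i\<in>I. \<bar>\<phi> i x\<bar> powr p"
  shows "pos_def (\<lambda>x. (real (card I) / p - t * N x) * exp (- t * N x))"
proof -
  define f where "f i x = exp (- t * \<bar>\<phi> i x\<bar> powr p)" for i x
  have f: "exp (- t * N x) = (\<Prod>j\<in>I. f j x)" for x
    using I by (simp add: N_def f_def exp_sum sum_distrib_left flip: sum_negf)
  have "multiplier (\<lambda>x. \<Sum>i\<in>I. (1 / p - t * \<bar>\<phi> i x\<bar> powr p) * f i x * (\<Prod>j\<in>I - {i}. f j x))"
    unfolding f_def
    by (intro multiplier_sum multiplier_mult[OF _ multiplier_prod] multiplier_exp_powr_deriv multiplier_exp_powr assms)
  also have "(\<lambda>x. \<Sum>i\<in>I. (1 / p - t * \<bar>\<phi> i x\<bar> powr p) * f i x * (\<Prod>j\<in>I - {i}. f j x))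
    = (\<lambda>x. (real (card I) / p - t * N x) * exp (- t * N x))"
  proof
    fix x
    have "(\<Sum>i\<in>I. (1 / p - t * \<bar>\<phi> i x\<bar> powr p) * f i x * (\<Prod>j\<in>I - {i}. f j x))
      = (\<Sum>i\<in>I. (1 / p - t * \<bar>\<phi> i x\<bar> powr p) * exp (- t * N x))"
      unfolding f using I by (intro sum.cong) (simp_all add: prod.remove mult.assoc)
    also have "\<dots> = (real (card I) / p - t * N x) * exp (- t * N x)"
      by (simp add: N_def sum_subtractf sum_distrib_left left_diff_distrib flip: sum_distrib_right)
    finally show "(\<Sum>i\<in>I. (1 / p - t * \<bar>\<phi> i x\<bar> powr p) * f i x * (\<Prod>j\<in>I - {i}. f j x))
      = (real (card I) / p - t * N x) * exp (- t * N x)" .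
  qed
  finally show ?thesis by (rule multiplier_imp_pos_def)
qed


section \<open>Averaging over boxes in the integer lattice\<close>

text \<open>
  Apply positive definiteness with unit coefficients to all points of a box \<open>B\<close> of side \<open>L\<close>. The
  row of a point \<open>x\<close> of \<open>B\<close> is a sum of values \<open>g(x - y)\<close>; it contains \<open>g(0)\<close>, and all its other
  terms are nonpositive, so it is at most \<open>g(0)\<close>. If \<open>x\<close> lies deep enough inside \<open>B\<close>, then
  \<open>x - k\<close> stays in \<open>B\<close> for all \<open>k \<in> F\<close> and the row is even at most \<open>g(0)\<close> plus the sum over
  \<open>F\<close>. The proportion of such deep points tends to \<open>1\<close> as \<open>L\<close> grows.

  Elements of \<open>\<int>^n\<close> are functions that vanish from \<open>n\<close> on.
\<close>

lemma pos_def_int_functions_sum_nonneg: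
  fixes g :: "(nat \<Rightarrow> int) \<Rightarrow> real"
  assumes g: "pos_def g"
    and nonpos: "\<And>k. \<forall>j\<ge>n. k j = 0 \<Longrightarrow> k \<noteq> (\<lambda>_. 0) \<Longrightarrow> g k \<le> 0"
    and F: "finite F" "\<And>k. k \<in> F \<Longrightarrow> (\<forall>j\<ge>n. k j = 0) \<and> k \<noteq> (\<lambda>_. 0)"
  shows "0 \<le> g (\<lambda>_. 0) + (\<Sum>k\<in>F. g k)"
proof -
  define M where "M = nat (Max (insert 0 ((\<lambda>(k, j). \<bar>k j\<bar>) ` (F \<times> {..<n}))))"
  have M: "\<bar>k j\<bar> \<le> int M" if "k \<in> F" "j < n" for k j
  proof -
    have "\<bar>k j\<bar> \<le> Max (insert 0 ((\<lambda>(k, j). \<bar>k j\<bar>) ` (F \<times> {..<n})))"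
      using that F(1) by (intro Max_ge) force+
    then show ?thesis unfolding M_def by linarith
  qed
  define \<Sigma> where "\<Sigma> = (\<Sum>k\<in>F. g k)"
  have bound: "0 \<le> g (\<lambda>_. 0) + (real (Suc m) / real (2 * M + Suc m)) ^ n * \<Sigma>" for m
  proof -
    define L where "L = 2 * M + Suc m"
    \<comment> \<open>The points of \<open>B\<close> take the value \<open>undefined\<close> from \<open>n\<close> on. It cancels in differences, and
      subtracting an element of \<open>F\<close> leaves it unchanged.\<close>
    define B :: "(nat \<Rightarrow> int) set" where "B = PiE {..<n} (\<lambda>_. {0..<int L})"
    define J :: "(nat \<Rightarrow> int) set" where "J = PiE {..<n} (\<lambda>_. {int M..<int (M + Suc m)})"
    have B: "finite B" "card B = L ^ n"
      unfolding B_def by (intro finite_PiE, simp_all add: card_PiE)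
    have J: "J \<subseteq> B" "card J = Suc m ^ n"
      unfolding J_def B_def L_def by (intro PiE_mono, simp_all add: card_PiE nat_add_distrib)
    have row: "(\<Sum>y\<in>B. g (x - y)) \<le> g (\<lambda>_. 0) + (\<Sum>k\<in>F'. g k)"
      if x: "x \<in> B" and F': "F' \<subseteq> F" "\<And>k. k \<in> F' \<Longrightarrow> x - k \<in> B" for x F'
    proof -
      let ?D = "(\<lambda>y. x - y) ` B"
      have inj: "inj_on (\<lambda>y. x - y) B"
      proof (intro inj_onI ext)
        fix y z j assume "x - y = x - z"
        from fun_cong[OF this, of j] show "y j = z j" by simp
      qed
      have zero: "x - x = (\<lambda>_. 0)" by (simp add: fun_diff_def)
      have sub: "insert (\<lambda>_. 0) F' \<subseteq> ?D"
      proof -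
        have "k \<in> ?D" if "k \<in> F'" for k
        proof (rule image_eqI)
          show "k = x - (x - k)" by (simp add: fun_eq_iff)
        qed (rule F'(2)[OF that])
        moreover have "(\<lambda>_. 0) \<in> ?D" using zero[symmetric] x by (rule image_eqI)
        ultimately show ?thesis by blast
      qed
      have supp: "\<forall>j\<ge>n. k j = 0" if "k \<in> ?D" for k
        using that x by (auto simp: B_def PiE_iff extensional_def)
      have "(\<Sum>y\<in>B. g (x - y)) = (\<Sum>k\<in>?D. g k)"
        using sum.reindex[OF inj, of g] by simp
      also have "\<dots> = (\<Sum>k\<in>?D - insert (\<lambda>_. 0) F'. g k) + (\<Sum>k\<in>insert (\<lambda>_. 0) F'. g k)"
        using B(1) by (intro sum.subset_diff[OF sub]) simp
      also have "\<dots> \<le> (\<Sum>k\<in>insert (\<lambda>_. 0) F'. g k)"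
        using nonpos supp by (auto intro!: sum_nonpos)
      also have "\<dots> = g (\<lambda>_. 0) + (\<Sum>k\<in>F'. g k)"
        using F F'(1) by (subst sum.insert) (auto intro: finite_subset)
      finally show ?thesis .
    qed
    have "0 \<le> (\<Sum>x\<in>B. \<Sum>y\<in>B. g (x - y))"
      using pos_defD[OF g B(1), of "\<lambda>_. 1"] by simp
    also have "\<dots> \<le> (\<Sum>x\<in>B. g (\<lambda>_. 0) + (if x \<in> J then \<Sigma> else 0))"
    proof (rule sum_mono)
      fix x assume x: "x \<in> B"
      show "(\<Sum>y\<in>B. g (x - y)) \<le> g (\<lambda>_. 0) + (if x \<in> J then \<Sigma> else 0)"
      proof (cases "x \<in> J")
        case True
        have "x - k \<in> B" if "k \<in> F" for k
        proof -
          have "0 \<le> x j - k j \<and> x j - k j < int L" if "j < n" for j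
          proof -
            have "int M \<le> x j" "x j < int (M + Suc m)"
              using True that by (auto simp: J_def PiE_iff)
            with M[OF \<open>k \<in> F\<close> that] show ?thesis by (auto simp: L_def abs_le_iff)
          qed
          moreover have "x j - k j = undefined" if "\<not> j < n" for j
            using True F(2)[OF \<open>k \<in> F\<close>] that by (auto simp: J_def PiE_iff extensional_def)
          ultimately show ?thesis by (auto simp: B_def PiE_iff extensional_def)
        qed
        with row[OF x, of F] True show ?thesis by (simp add: \<Sigma>_def)
      next
        case False
        with row[OF x, of "{}"] show ?thesis by simp
      qed
    qed
    also have "\<dots> = real (L ^ n) * g (\<lambda>_. 0) + real (Suc m ^ n) * \<Sigma>"
      using B J by (simp add: sum.distrib sum.If_cases Int_absorb1)
    finally have "0 \<le> (real (L ^ n) * g (\<lambda>_. 0) + real (Suc m ^ n) * \<Sigma>) / real (L ^ n)"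
      by simp
    also have "\<dots> = g (\<lambda>_. 0) + (real (Suc m) / real L) ^ n * \<Sigma>"
    proof -
      have "real L ^ n \<noteq> 0" by (simp add: L_def)
      then show ?thesis by (simp add: add_divide_distrib power_divide del: of_nat_Suc)
    qed
    finally show ?thesis by (simp only: L_def)
  qed
  have base: "(\<lambda>m. real (Suc m) / real (2 * M + Suc m)) \<longlonglongrightarrow> 1"
    by real_asymp
  have "(\<lambda>m. g (\<lambda>_. 0) + (real (Suc m) / real (2 * M + Suc m)) ^ n * \<Sigma>) \<longlonglongrightarrow> g (\<lambda>_. 0) + 1 ^ n * \<Sigma>"
    by (intro tendsto_add tendsto_const tendsto_mult_right tendsto_power base)
  then have "0 \<le> g (\<lambda>_. 0) + 1 ^ n * \<Sigma>"
    by (rule LIMSEQ_le_const) (use bound in blast)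
  then show ?thesis by (simp add: \<Sigma>_def)
qed

section \<open>Counting short vectors\<close>

text \<open>
  The parameter \<open>t\<close> satisfies \<open>t s = n/p + 1\<close>: it is the least value for which \<open>N(k) \<ge> s\<close> forces
  the factor \<open>n/p - t N(k)\<close> to be at most \<open>-1\<close>. Then \<open>g(0) = n/p\<close> has to outweigh the sum over
  \<open>F\<close>, each term of which is at most \<open>- exp(-U (n/p + 1))\<close>.
\<close>

lemma card_short_vectors_le:
  fixes \<phi> :: "nat \<Rightarrow> (nat \<Rightarrow> int) \<Rightarrow> real" and n :: nat
  assumes add: "\<And>i x y. \<phi> i (x - y) = \<phi> i x - \<phi> i y" and p: "0 < p" "p \<le> 2"
  defines "N \<equiv> \<lambda>k. \<Sum>i<n. \<bar>\<phi> i k\<bar> powr p"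
  assumes s: "0 < s" "\<And>k. \<forall>j\<ge>n. k j = 0 \<Longrightarrow> k \<noteq> (\<lambda>_. 0) \<Longrightarrow> s \<le> N k"
    and F: "finite F" "\<And>k. k \<in> F \<Longrightarrow> (\<forall>j\<ge>n. k j = 0) \<and> k \<noteq> (\<lambda>_. 0) \<and> N k \<le> U * s"
  shows "real (card F) \<le> real n / p * exp (U * (real n / p + 1))"
proof -
  define t where "t = (real n / p + 1) / s"
  have t: "0 < t" using p s by (simp add: t_def add_nonneg_pos)
  define g where "g k = (real n / p - t * N k) * exp (- t * N k)" for k
  have g: "pos_def g"
    unfolding g_def N_def
    using pos_def_theta_deriv[of "{..<n}" \<phi> p t] add p t by simp
  have g_le: "g k \<le> - exp (- t * N k)" if "\<forall>j\<ge>n. k j = 0" "k \<noteq> (\<lambda>_. 0)" for k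
  proof -
    have "real n / p + 1 = t * s" using s by (simp add: t_def)
    also have "\<dots> \<le> t * N k" using s(2)[OF that] t by simp
    finally have "(real n / p - t * N k) * exp (- t * N k) \<le> (- 1) * exp (- t * N k)"
      by (intro mult_right_mono) auto
    then show ?thesis by (simp add: g_def)
  qed
  have "\<phi> i (\<lambda>_. 0) = 0" for i
    using add[of i "\<lambda>_. 0" "\<lambda>_. 0"] by (simp add: fun_diff_def)
  then have g0: "g (\<lambda>_. 0) = real n / p"
    by (simp add: g_def N_def)
  define \<epsilon> where "\<epsilon> = exp (- (U * (real n / p + 1)))"
  have "g k \<le> - \<epsilon>" if "k \<in> F" for k
  proof -
    have "t * N k \<le> t * (U * s)" using F(2)[OF that] t by simp
    also have "\<dots> = U * (real n / p + 1)" using s by (simp add: t_def)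
    finally have "\<epsilon> \<le> exp (- t * N k)" by (simp add: \<epsilon>_def)
    with g_le[of k] F(2)[OF that] show ?thesis by simp
  qed
  then have "(\<Sum>k\<in>F. g k) \<le> (\<Sum>k\<in>F. - \<epsilon>)" by (rule sum_mono)
  moreover have "0 \<le> g (\<lambda>_. 0) + (\<Sum>k\<in>F. g k)"
  proof (rule pos_def_int_functions_sum_nonneg[OF g _ F(1)])
    show "g k \<le> 0" if "\<forall>j\<ge>n. k j = 0" "k \<noteq> (\<lambda>_. 0)" for k
      using g_le[OF that] exp_ge_zero[of "- t * N k"] by linarith
  qed (use F(2) in blast)
  ultimately have "real (card F) / exp (U * (real n / p + 1)) \<le> real n / p"
    using g0 by (simp add: \<epsilon>_def exp_minus divide_inverse)
  then show ?thesis
    by (simp only: pos_divide_le_eq[OF exp_gt_zero])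
qed

section \<open>Lattices in coordinates\<close>

text \<open>
  Here \<open>b\<close> holds the coordinates of the basis vectors and \<open>a\<close> the inverse of the matrix with these
  columns. The second property recovers the integer coefficients of a lattice point from the point,
  which yields both the injectivity of the parametrization and the discreteness of the lattice.
\<close>

lemma real_lattice_coordinates:
  assumes "real_lattice n L"
  obtains b a :: "nat \<Rightarrow> nat \<Rightarrow> real" where
    "L = (\<lambda>c. Matrix.vec n (\<lambda>i. \<Sum>j<n. of_int (c j) * b j i)) ` {c :: nat \<Rightarrow> int. \<forall>j\<ge>n. c j = 0}"
    "\<And>c l. l < n \<Longrightarrow> of_int (c l) = (\<Sum>i<n. a l i * (\<Sum>j<n. of_int (c j) * b j i))"
proof -
  interpret vec_space "TYPE(real)" n .
  from assms obtain bs where bs: "distinct bs" "basis (set bs)" "L = lattice_of bs"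
    unfolding real_lattice_def by auto
  have carr: "set bs \<subseteq> carrier_vec n" and li: "lin_indpt (set bs)"
    using bs(2) unfolding basis_def by auto
  have len: "length bs = n"
    using dim_basis[OF _ bs(2)] dim_is_n distinct_card[OF bs(1)] by simp
  define A where "A = mat_of_cols n bs"
  have A: "A \<in> carrier_mat n n" unfolding A_def using len mat_of_cols_carrier(1)[of n bs] by simp
  have cols: "cols A = bs" unfolding A_def by (rule cols_mat_of_cols[OF carr])
  have "rank A = n" by (rule lin_indpt_full_rank[OF A]) (use cols bs li in auto)
  then have "Determinant.det A \<noteq> 0" using det_rank_iff[OF A] by simp
  then obtain B where B: "B \<in> carrier_mat n n" "B * A = 1\<^sub>m n"
    using det_non_zero_imp_unit[OF A] unfolding Units_def ring_mat_simps by blast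
  define b where "b j i = vec_index (bs ! j) i" for j i
  define a where "a l i = B $$ (l, i)" for l i
  have Aij: "A $$ (i, j) = b j i" if "i < n" "j < n" for i j
    using that len by (simp add: A_def b_def mat_of_cols_index)
  show ?thesis
  proof (rule that)
    let ?x = "\<lambda>c. Matrix.vec n (\<lambda>i. \<Sum>j<n. of_int (c j) * b j i)"
    have comb: "sumlist (map (\<lambda>j. of_int (c j) \<cdot>\<^sub>v bs ! j) [0 ..< length bs]) = ?x c" (is "?s = _") for c
    proof (rule eq_vecI)
      have bs_dim: "dim_vec (bs ! j) = n" if "j < n" for j
        using carr nth_mem[of j bs] that len by (metis carrier_vecD subsetD)
      then have dims: "dim_vec x = n" if "x \<in> set (map (\<lambda>j. of_int (c j) \<cdot>\<^sub>v bs ! j) [0 ..< length bs])" for x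
        using that len bs_dim by (auto simp del: upt_Suc)
      show "dim_vec ?s = dim_vec (?x c)"
      proof -
        have "dim_vec ?s = n" by (rule sumlist_dim, rule carrier_vecI, rule dims)
        then show ?thesis by (simp only: dim_vec)
      qed
      show "vec_index ?s i = vec_index (?x c) i" if "i < dim_vec (?x c)" for i
      proof -
        have i: "i < n" using that by simp
        have "vec_index ?s i = (\<Sum>j<n. vec_index (map (\<lambda>j. of_int (c j) \<cdot>\<^sub>v bs ! j) [0 ..< n] ! j) i)"
        proof -
          have "vec_index ?s i = (\<Sum>j\<in>{0..<length (map (\<lambda>j. of_int (c j) \<cdot>\<^sub>v bs ! j) [0 ..< length bs])}.
              vec_index (map (\<lambda>j. of_int (c j) \<cdot>\<^sub>v bs ! j) [0 ..< length bs] ! j) i)"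
            by (rule sumlist_nth, rule ballI, rule dims, assumption, rule i)
          then show ?thesis by (simp only: len length_map length_upt diff_zero atLeast0LessThan)
        qed
        also have "\<dots> = (\<Sum>j<n. of_int (c j) * b j i)"
          by (intro sum.cong refl) (simp add: b_def bs_dim i)
        finally show ?thesis using i by simp
      qed
    qed
    show "L = ?x ` {c :: nat \<Rightarrow> int. \<forall>j\<ge>n. c j = 0}"
    proof -
      have "?x c \<in> ?x ` {c :: nat \<Rightarrow> int. \<forall>j\<ge>n. c j = 0}" for c :: "nat \<Rightarrow> int"
        by (rule image_eqI[of _ _ "\<lambda>j. if j < n then c j else 0"]) auto
      then show ?thesis unfolding bs(3) lattice_of_def comb by auto
    qed
    show "of_int (c l) = (\<Sum>i<n. a l i * (\<Sum>j<n. of_int (c j) * b j i))" if l: "l < n" for c l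
    proof -
      have BA: "(\<Sum>i<n. a l i * b j i) = (if l = j then 1 else 0)" if "j < n" for j
      proof -
        have "(B * A) $$ (l, j) = (\<Sum>i<n. a l i * b j i)"
          using A B(1) l that
          by (simp add: scalar_prod_def a_def atLeast0LessThan Aij)
        then show ?thesis using B(2) l that by simp
      qed
      have "(\<Sum>i<n. a l i * (\<Sum>j<n. of_int (c j) * b j i)) = (\<Sum>j<n. of_int (c j) * (\<Sum>i<n. a l i * b j i))"
        by (simp add: sum_distrib_left mult_ac) (rule sum.swap)
      also have "\<dots> = (\<Sum>j<n. if l = j then of_int (c j) else 0)"
        by (intro sum.cong) (simp_all add: BA)
      also have "\<dots> = of_int (c l)" using l by simp
      finally show ?thesis by simp
    qed
  qed
qed

lemma finite_bounded_coordinates: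
  fixes a :: "nat \<Rightarrow> nat \<Rightarrow> real" and \<phi> :: "nat \<Rightarrow> (nat \<Rightarrow> int) \<Rightarrow> real"
  assumes p: "0 < p" and coeff: "\<And>c l. l < n \<Longrightarrow> of_int (c l) = (\<Sum>i<n. a l i * \<phi> i c)"
  shows "finite {c. (\<forall>j\<ge>n. c j = 0) \<and> (\<Sum>i<n. \<bar>\<phi> i c\<bar> powr p) \<le> R}" (is "finite ?C")
proof -
  define r where "r = \<bar>R\<bar> powr (1 / p)"
  define K where "K = (\<Sum>l<n. \<Sum>i<n. \<bar>a l i\<bar> * r)"
  have bound: "\<bar>c l\<bar> \<le> \<lceil>K\<rceil>" if c: "c \<in> ?C" and l: "l < n" for c l
  proof -
    have phi: "\<bar>\<phi> i c\<bar> \<le> r" if "i < n" for i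
    proof -
      have "\<bar>\<phi> i c\<bar> powr p \<le> (\<Sum>i<n. \<bar>\<phi> i c\<bar> powr p)"
        using that by (intro member_le_sum) auto
      also have "\<dots> \<le> \<bar>R\<bar>" using c by auto
      finally have "(\<bar>\<phi> i c\<bar> powr p) powr (1 / p) \<le> r"
        unfolding r_def using p by (intro powr_mono2) auto
      then show ?thesis using p by (simp add: powr_powr)
    qed
    have "\<bar>real_of_int (c l)\<bar> \<le> (\<Sum>i<n. \<bar>a l i * \<phi> i c\<bar>)"
      unfolding coeff[OF l] by (rule sum_abs)
    also have "\<dots> \<le> (\<Sum>i<n. \<bar>a l i\<bar> * r)"
      unfolding abs_mult using phi by (intro sum_mono mult_left_mono) auto
    also have "\<dots> \<le> K"
      unfolding K_def using l by (intro member_le_sum[of l]) (auto intro!: sum_nonneg simp: r_def)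
    finally show ?thesis by linarith
  qed
  have "?C \<subseteq> {c. \<forall>l. (l \<in> {..<n} \<longrightarrow> c l \<in> {- \<lceil>K\<rceil>..\<lceil>K\<rceil>}) \<and> (l \<notin> {..<n} \<longrightarrow> c l = 0)}"
  proof (intro subsetI CollectI allI conjI impI)
    fix c l
    assume c: "c \<in> ?C"
    show "c l \<in> {- \<lceil>K\<rceil>..\<lceil>K\<rceil>}" if "l \<in> {..<n}"
      using bound[OF c, of l] that by (simp add: abs_le_iff)
    show "c l = 0" if "l \<notin> {..<n}"
      using c that by simp
  qed
  then show ?thesis
    by (rule finite_subset) (rule finite_set_of_finite_funs; simp)
qed

lemma lp_min_length_attained:
  assumes fin: "\<And>R. finite {x \<in> L. lp_length p x \<le> R}" and ne: "L - {0\<^sub>v n} \<noteq> {}"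
  shows "lp_min_length p n L \<in> lp_length p ` (L - {0\<^sub>v n})"
    and "\<And>x. x \<in> L - {0\<^sub>v n} \<Longrightarrow> lp_min_length p n L \<le> lp_length p x"
proof -
  from ne obtain y where y: "y \<in> L - {0\<^sub>v n}" by blast
  define T where "T = {x \<in> L - {0\<^sub>v n}. lp_length p x \<le> lp_length p y}"
  have T: "finite T" "y \<in> T"
    using y fin[of "lp_length p y"] unfolding T_def by (auto elim: rev_finite_subset)
  define \<mu> where "\<mu> = Min (lp_length p ` T)"
  have \<mu>_in: "\<mu> \<in> lp_length p ` (L - {0\<^sub>v n})"
  proof -
    have "\<mu> \<in> lp_length p ` T" unfolding \<mu>_def using T by (intro Min_in) auto
    then show ?thesis by (auto simp: T_def)
  qed
  have \<mu>_le: "\<mu> \<le> lp_length p x" if "x \<in> L - {0\<^sub>v n}" for x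
  proof (cases "x \<in> T")
    case True
    then show ?thesis unfolding \<mu>_def using T by (intro Min_le) auto
  next
    case False
    have "\<mu> \<le> lp_length p y" unfolding \<mu>_def using T by (intro Min_le) auto
    with False that show ?thesis by (auto simp: T_def)
  qed
  have "lp_min_length p n L = \<mu>"
    unfolding lp_min_length_def
  proof (rule Least_equality)
    show "\<mu> \<le> r" if "r \<in> lp_length p ` (L - {0\<^sub>v n})" for r
      using that \<mu>_le by blast
  qed (rule \<mu>_in)
  then show "lp_min_length p n L \<in> lp_length p ` (L - {0\<^sub>v n})"
    and "\<And>x. x \<in> L - {0\<^sub>v n} \<Longrightarrow> lp_min_length p n L \<le> lp_length p x"
    using \<mu>_in \<mu>_le by (simp_all only:)
qed

lemma lp_length_vec:
  assumes "0 < p"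
  shows "lp_length p (Matrix.vec n f) powr p = (\<Sum>i<n. \<bar>f i\<bar> powr p)"
  using assms by (simp add: lp_length_def powr_powr sum_nonneg)

lemma lp_length_nonneg: "0 \<le> lp_length p x"
  by (simp add: lp_length_def)

section \<open>Short lattice vectors\<close>

lemma lattice_short_vectors:
  assumes n: "n \<ge> 1" and p: "0 < p" "p \<le> 2" and L: "real_lattice n L" and u: "0 \<le> u"
  defines "\<sigma> \<equiv> lp_min_length p n L"
  shows "0 < \<sigma>"
    and "finite {x \<in> L - {0\<^sub>v n}. lp_length p x \<le> u * \<sigma>}"
    and "real (card {x \<in> L - {0\<^sub>v n}. lp_length p x \<le> u * \<sigma>})
      \<le> real n / p * exp (u powr p * (real n / p + 1))"
proof -
  obtain b a :: "nat \<Rightarrow> nat \<Rightarrow> real" where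
    L_eq: "L = (\<lambda>c. Matrix.vec n (\<lambda>i. \<Sum>j<n. of_int (c j) * b j i)) ` {c :: nat \<Rightarrow> int. \<forall>j\<ge>n. c j = 0}"
    and coeff: "\<And>c l. l < n \<Longrightarrow> of_int (c l) = (\<Sum>i<n. a l i * (\<Sum>j<n. of_int (c j) * b j i))"
    using real_lattice_coordinates[OF L] by blast
  define \<phi> :: "nat \<Rightarrow> (nat \<Rightarrow> int) \<Rightarrow> real" where "\<phi> i c = (\<Sum>j<n. of_int (c j) * b j i)" for i c
  define V where "V c = Matrix.vec n (\<lambda>i. \<phi> i c)" for c
  define N where "N c = (\<Sum>i<n. \<bar>\<phi> i c\<bar> powr p)" for c
  define Z where "Z = {c :: nat \<Rightarrow> int. \<forall>j\<ge>n. c j = 0}"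
  have L_V: "L = V ` Z" unfolding L_eq V_def \<phi>_def Z_def ..
  have coeff': "of_int (c l) = (\<Sum>i<n. a l i * \<phi> i c)" if "l < n" for c l
    unfolding \<phi>_def by (rule coeff[OF that])
  have len: "lp_length p (V c) powr p = N c" for c
    unfolding V_def N_def by (rule lp_length_vec[OF p(1)])
  have V0: "V c = 0\<^sub>v n \<longleftrightarrow> c = (\<lambda>_. 0)" if "c \<in> Z" for c
  proof
    assume "V c = 0\<^sub>v n"
    then have "\<phi> i c = 0" if "i < n" for i
      using that unfolding V_def by (metis index_vec index_zero_vec(1))
    then have "c l = 0" if "l < n" for l
      using coeff'[OF that, of c] by simp
    then show "c = (\<lambda>_. 0)" using that unfolding Z_def by (metis (mono_tags) ext mem_Collect_eq not_le)
  qed (simp add: V_def \<phi>_def zero_vec_def)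
  have finZ: "finite {c \<in> Z. N c \<le> R}" for R
    using finite_bounded_coordinates[OF p(1) coeff', of R] unfolding Z_def N_def by simp
  have fin: "finite {x \<in> L. lp_length p x \<le> R}" for R
  proof (rule finite_subset)
    show "{x \<in> L. lp_length p x \<le> R} \<subseteq> V ` {c \<in> Z. N c \<le> \<bar>R\<bar> powr p}"
    proof safe
      fix x assume "x \<in> L" "lp_length p x \<le> R"
      then obtain c where c: "c \<in> Z" "x = V c" unfolding L_V by blast
      have "N c \<le> \<bar>R\<bar> powr p"
        unfolding len[symmetric] using \<open>lp_length p x \<le> R\<close> c p lp_length_nonneg[of p x]
        by (intro powr_mono2) auto
      with c show "x \<in> V ` {c \<in> Z. N c \<le> \<bar>R\<bar> powr p}" by blast
    qed
    show "finite (V ` {c \<in> Z. N c \<le> \<bar>R\<bar> powr p})" using finZ by blast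
  qed
  \<comment> \<open>The first basis vector shows that nonzero lattice points exist.\<close>
  have "V (\<lambda>j. if j = 0 then 1 else 0) \<in> L - {0\<^sub>v n}"
  proof -
    have "(\<lambda>j. if j = 0 then 1 else 0) \<in> Z" using n by (auto simp: Z_def)
    moreover have "(\<lambda>j. if j = 0 then 1 else 0) \<noteq> (\<lambda>_::nat. 0::int)" by (auto simp: fun_eq_iff)
    ultimately show ?thesis using V0 unfolding L_V by blast
  qed
  then have ne: "L - {0\<^sub>v n} \<noteq> {}" by blast
  note attained = lp_min_length_attained[of L p, OF fin ne, folded \<sigma>_def]
  have pos: "0 < lp_length p x" if "x \<in> L - {0\<^sub>v n}" for x
  proof -
    from that obtain c where c: "c \<in> Z" "x = V c" "c \<noteq> (\<lambda>_. 0)" using V0 unfolding L_V by blast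
    have "N c \<noteq> 0"
    proof
      assume "N c = 0"
      then have "\<forall>i\<in>{..<n}. \<bar>\<phi> i c\<bar> powr p = 0"
        unfolding N_def by (subst (asm) sum_nonneg_eq_0_iff) auto
      then have "V c = 0\<^sub>v n" by (intro eq_vecI) (auto simp: V_def)
      with c V0 show False by blast
    qed
    then have "lp_length p x \<noteq> 0" using len[of c] c by auto
    with lp_length_nonneg[of p x] show ?thesis by linarith
  qed
  show \<sigma>: "0 < \<sigma>" using attained(1) pos by auto
  let ?S = "{x \<in> L - {0\<^sub>v n}. lp_length p x \<le> u * \<sigma>}"
  show "finite ?S" using fin[of "u * \<sigma>"] by (rule rev_finite_subset) auto
  define F where "F = {c \<in> Z. N c \<le> u powr p * \<sigma> powr p} - {\<lambda>_. 0}"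
  have F: "finite F" unfolding F_def using finZ by blast
  have "?S \<subseteq> V ` F"
  proof
    fix x assume "x \<in> ?S"
    then have x: "x \<in> L" "x \<noteq> 0\<^sub>v n" "lp_length p x \<le> u * \<sigma>" by auto
    then obtain c where c: "c \<in> Z" "x = V c" "c \<noteq> (\<lambda>_. 0)" using V0 unfolding L_V by blast
    have "N c \<le> (u * \<sigma>) powr p"
      unfolding len[symmetric] using x c p lp_length_nonneg[of p x] by (intro powr_mono2) auto
    also have "\<dots> = u powr p * \<sigma> powr p" using u \<sigma> by (simp add: powr_mult)
    finally show "x \<in> V ` F" using c by (auto simp: F_def)
  qed
  then have "card ?S \<le> card F"
    using F by (meson card_image_le card_mono finite_imageI le_trans)
  moreover have "real (card F) \<le> real n / p * exp (u powr p * (real n / p + 1))"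
  proof (rule card_short_vectors_le[where \<phi> = \<phi> and s = "\<sigma> powr p"])
    show "\<phi> i (x - y) = \<phi> i x - \<phi> i y" for i x y
      by (simp add: \<phi>_def left_diff_distrib sum_subtractf)
    show "\<sigma> powr p \<le> (\<Sum>i<n. \<bar>\<phi> i c\<bar> powr p)" if "\<forall>j\<ge>n. c j = 0" "c \<noteq> (\<lambda>_. 0)" for c
    proof -
      have "V c \<in> L - {0\<^sub>v n}" using that V0[of c] unfolding L_V Z_def by blast
      from attained(2)[OF this] show ?thesis
        using \<sigma> p unfolding N_def[symmetric] len[symmetric] by (intro powr_mono2) auto
    qed
  qed (use p \<sigma> F in \<open>auto simp: F_def Z_def N_def\<close>)
  ultimately show "real (card ?S) \<le> real n / p * exp (u powr p * (real n / p + 1))"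
    by linarith
qed

theorem theorem3p12:
  shows "(\<forall>(n::nat) (p::real) (L :: real vec set) (u::real).
            n \<ge> 1 \<longrightarrow> 0 < p \<longrightarrow> p \<le> 2 \<longrightarrow> real_lattice n L \<longrightarrow> u \<ge> 1 \<longrightarrow>
              finite {x \<in> L - {0\<^sub>v n}. lp_length p x \<le> u * lp_min_length p n L} \<and>
              real (card {x \<in> L - {0\<^sub>v n}. lp_length p x \<le> u * lp_min_length p n L})
                \<le> 10 * (exp (u powr p) * real n / p) * exp (u powr p * real n / p))
       \<and> (\<exists>C::real. \<forall>(n::nat) (p::real) (L :: real vec set).
            n \<ge> 1 \<longrightarrow> 0 < p \<longrightarrow> p \<le> 2 \<longrightarrow> real_lattice n L \<longrightarrow>
              finite {x \<in> L. lp_length p x = lp_min_length p n L} \<and>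
              real (card {x \<in> L. lp_length p x = lp_min_length p n L})
                \<le> C * (real n / p * exp (real n / p)))"
proof (intro conjI allI impI exI[of _ "exp 1"])
  fix n :: nat and p u :: real and L :: "real vec set"
  assume asm: "n \<ge> 1" "0 < p" "p \<le> 2" "real_lattice n L" "u \<ge> 1"
  let ?S = "{x \<in> L - {0\<^sub>v n}. lp_length p x \<le> u * lp_min_length p n L}"
  have u: "0 \<le> u" using asm(5) by simp
  note short = lattice_short_vectors[OF asm(1-4) u]
  show "finite ?S" by (rule short)
  define Y where "Y = exp (u powr p) * real n / p * exp (u powr p * real n / p)"
  have "real (card ?S) \<le> real n / p * exp (u powr p * (real n / p + 1))" by (rule short)
  also have "\<dots> = Y"
    by (simp add: Y_def distrib_left exp_add mult_ac)
  also have "Y \<le> 10 * Y"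
  proof -
    have "0 \<le> Y" unfolding Y_def using asm(2) by (intro mult_nonneg_nonneg divide_nonneg_pos) auto
    then show ?thesis by linarith
  qed
  finally show "real (card ?S) \<le> 10 * (exp (u powr p) * real n / p) * exp (u powr p * real n / p)"
    by (simp add: Y_def mult.assoc)
next
  fix n :: nat and p :: real and L :: "real vec set"
  assume asm: "n \<ge> 1" "0 < p" "p \<le> 2" "real_lattice n L"
  let ?\<sigma> = "lp_min_length p n L"
  let ?S = "{x \<in> L - {0\<^sub>v n}. lp_length p x \<le> 1 * ?\<sigma>}"
  note short = lattice_short_vectors[OF asm zero_le_one]
  have "lp_length p (0\<^sub>v n) = 0" by (simp add: lp_length_def)
  then have sub: "{x \<in> L. lp_length p x = ?\<sigma>} \<subseteq> ?S" using short(1) by auto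
  show "finite {x \<in> L. lp_length p x = ?\<sigma>}" by (rule finite_subset[OF sub short(2)])
  have "real (card {x \<in> L. lp_length p x = ?\<sigma>}) \<le> real (card ?S)"
    using card_mono[OF short(2) sub] by simp
  also have "\<dots> \<le> real n / p * exp (1 powr p * (real n / p + 1))" by (rule short)
  also have "\<dots> = exp 1 * (real n / p * exp (real n / p))"
    by (simp add: exp_add)
  finally show "real (card {x \<in> L. lp_length p x = ?\<sigma>}) \<le> exp 1 * (real n / p * exp (real n / p))" .
qed

end
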